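(* Let $(F_n)_{n\in\mathbb{Z}}$ be the Fibonacci numbers and $(G_n)_{n\in\mathbb{Z}}$ a Fibonacci-like sequence. For every positive integer $k$ and all integers $a$, $b$, $n$, $m$ the following six identities hold: \[ \sum_{j=0}^k (-1)^{(a+b+1)(k-j)}\binom kj F_{m-b}^j F_{m-a}^{k-j} G_{n-(m-b)k+(a-b)j}=F_{a-b}^k G_n, \] \[ \sum_{j=0}^k (-1)^{(a+b)j}\binom kj F_{a-b}^j F_{m-a}^{k-j} G_{n-(a-b)k+(m-b)j}=(-1)^{(a+b)k}F_{m-b}^k G_n, \] \[ \sum_{j=0}^k (-1)^{j}\binom kj F_{a-b}^j F_{m-b}^{k-j} G_{n+(a-b)k+(m-a)j}=(-1)^{(a+b)k}F_{m-a}^k G_n, \] \[ \sum_{j=0}^k (-1)^{(a+b+1)(k-j)}\binom kj F_{m+a}^j F_{m+b}^{k-j} G_{n-(m+a)k+(a-b)j}=F_{a-b}^k G_n, \] \[ \sum_{j=0}^k (-1)^{(a+b)j}\binom kj F_{a-b}^j F_{m+b}^{k-j} G_{n-(a-b)k+(m+a)j}=(-1)^{(a+b)k}F_{m+a}^k G_n, \] \[ \sum_{j=0}^k (-1)^{j}\binom kj F_{a-b}^j F_{m+a}^{k-j} G_{n+(a-b)k+(m+b)j}=(-1)^{(a+b)k}F_{m+b}^k G_n. \]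
   Context: The Fibonacci numbers are defined by $F_0=0$, $F_1=1$, $F_n=F_{n-1}+F_{n-2}$ for $n\ge 2$, and $F_{-n}=(-1)^{n-1}F_n$. A Fibonacci-like sequence $(G_n)_{n\in\mathbb{Z}}$ is defined by arbitrary integers $G_0,G_1$, not both zero, with $G_n=G_{n-1}+G_{n-2}$ for $n\ge 2$, extended to negative indices by $G_{-n}=G_{-n+2}-G_{-n+1}$. The convention $0^0=1$ is used for powers. *)

theory Defs
  imports Complex_Main "HOL-Number_Theory.Fib"
begin

text \<open>
  The library function \<open>fib\<close> on the natural numbers, extended to the integers by
  \<open>F (-r) = (-1) ^ (r - 1) * F r\<close> for \<open>r \<ge> 1\<close>.
\<close>

definition fib_int :: "int \<Rightarrow> int" where
  "fib_int i =
    (if i \<ge> 0 then int (fib (nat i))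
     else (-1) ^ (nat (- i) - 1) * int (fib (nat (- i))))"

definition fibonacci_like :: "(int \<Rightarrow> int) \<Rightarrow> bool" where
  "fibonacci_like G \<longleftrightarrow>
    \<not> (G 0 = 0 \<and> G 1 = 0) \<and>
    (\<forall>i\<ge>2. G i = G (i - 1) + G (i - 2)) \<and>
    (\<forall>i\<ge>1. G (- i) = G (- i + 2) - G (- i + 1))"

end

theory Submission
  imports Defs
begin

text \<open>
  Each identity is the \<open>k\<close>-fold iterate of a three-term relation
  \<open>x * G (n + p) + y * G (n + q) = z * G n\<close>: as an identity of shift operators,
  \<open>x * E\<^sup>p + y * E\<^sup>q = z\<close>, and its \<open>k\<close>-th power expands by the binomial theorem.
  The three-term relations are rearrangements of the single identity
  \<open>F (m - b) * G (N + a) - F (a - b) * G (N + m) = (-1) ^ (a + b) * F (m - a) * G (N + b)\<close>;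
  the last three identities follow from the first three by replacing \<open>(a, b)\<close> with \<open>(-b, -a)\<close>.
\<close>

text \<open>The forward clause of \<open>fibonacci_like\<close> at \<open>i + 2\<close> covers
  \<open>i \<ge> 0\<close>, the backward clause at \<open>- i\<close> covers \<open>i < 0\<close>;
  merging them lets all later arguments run over the integers without case splits.\<close>

lemma fibonacci_like_rec:
  assumes "fibonacci_like G"
  shows "G (i + 2) = G (i + 1) + G i"
proof (cases "i \<ge> 0")
  case True
  then have "G (i + 2) = G (i + 2 - 1) + G (i + 2 - 2)"
    using assms unfolding fibonacci_like_def by (metis add.commute le_add_same_cancel1)
  then show ?thesis by (simp add: algebra_simps)
next
  case False
  then have "G (- (- i)) = G (- (- i) + 2) - G (- (- i) + 1)"
    using assms unfolding fibonacci_like_def by (metis int_one_le_iff_zero_less neg_0_less_iff_less not_le)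
  then show ?thesis by simp
qed

lemma fib_int_0 [simp]: "fib_int 0 = 0"
  and fib_int_1 [simp]: "fib_int 1 = 1"
  by (simp_all add: fib_int_def)

lemma fib_int_rec: "fib_int (i + 2) = fib_int (i + 1) + fib_int i"
proof (cases "i \<ge> 0")
  case True
  then have "nat (i + 2) = Suc (Suc (nat i))" "nat (i + 1) = Suc (nat i)" by auto
  with True show ?thesis by (simp add: fib_int_def)
next
  case False
  define r where "r = nat (- i)"
  have i: "i = - int r" and "r > 0" using False by (auto simp: r_def)
  \<comment> \<open>For \<open>r = 1\<close> and \<open>r = 2\<close> at least one of
    \<open>i + 1\<close>, \<open>i + 2\<close> leaves the negative branch of \<open>fib_int\<close>;
    from \<open>r = 3\<close> on all three indices are negative and only the alternating signs
    matter.\<close>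
  consider "r = 1" | "r = 2" | t where "r = Suc (Suc (Suc t))"
    using \<open>r > 0\<close> by (metis One_nat_def Suc_1 gr0_implies_Suc not0_implies_Suc)
  then show ?thesis
  proof cases
    case 3
    have "nat (- (i + 2)) = Suc t" "nat (- (i + 1)) = Suc (Suc t)" "nat (- i) = Suc (Suc (Suc t))"
      and "i + 2 < 0" "i + 1 < 0" "i < 0"
      using i 3 by auto
    then show ?thesis by (simp add: fib_int_def algebra_simps)
  qed (simp_all add: i fib_int_def)
qed

text \<open>Serves as a uniqueness principle: an identity whose two sides obey the recurrence in a
  running index need only be checked at 0 and 1.\<close>

lemma two_sided_fib_rec_zero:
  fixes h :: "int \<Rightarrow> 'a::ab_group_add"
  assumes rec: "\<And>i. h (i + 2) = h (i + 1) + h i" and "h 0 = 0" and "h 1 = 0"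
  shows "h i = 0"
proof -
  \<comment> \<open>A pair of consecutive zeros propagates under the recurrence both upwards and
    downwards.\<close>
  have "h i = 0 \<and> h (i + 1) = 0"
  proof (induction i rule: int_induct[where k = 0])
    case base
    then show ?case using assms by simp
  next
    case (step1 i)
    then show ?case using rec[of i] by (simp add: add.assoc)
  next
    case (step2 i)
    then show ?case using rec[of "i - 1"] by (simp add: algebra_simps)
  qed
  then show ?thesis ..
qed

text \<open>The left side is a discrete Wronskian: moving \<open>p\<close> by one changes only its
  sign, and at \<open>p = 0\<close> it equals \<open>g N\<close>. Since \<open>p\<close> may be
  negative, the sign is a \<open>powi\<close>, hence the field.\<close>

lemma fib_cross_step:
  fixes f g :: "int \<Rightarrow> 'a::field"
  assumes f: "\<And>i. f (i + 2) = f (i + 1) + f i" "f 0 = 0" "f 1 = 1"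
    and g: "\<And>i. g (i + 2) = g (i + 1) + g i"
  shows "f (p + 1) * g (N + p) - f p * g (N + p + 1) = (-1) powi p * g N"
proof (induction p rule: int_induct[where k = 0])
  case base
  then show ?case using f by simp
next
  case (step1 p)
  have "f (p + 1 + 1) = f (p + 1) + f p" "g (N + (p + 1) + 1) = g (N + p + 1) + g (N + p)"
    using f(1)[of p] g[of "N + p"] by (simp_all add: add.assoc)
  moreover have "(-1 :: 'a) powi (p + 1) = - ((-1) powi p)"
    by (simp add: power_int_add)
  ultimately show ?case
    using step1.IH by (simp add: algebra_simps)
next
  case (step2 p)
  have "f (p + 1) = f p + f (p - 1)" "g (N + p + 1) = g (N + p) + g (N + p - 1)"
    using f(1)[of "p - 1"] g[of "N + p - 1"] by (simp_all add: algebra_simps)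
  moreover have "(-1 :: 'a) powi (p - 1) = - ((-1) powi p)"
    by (simp add: power_int_diff)
  ultimately show ?case
    using step2.IH by (simp add: algebra_simps)
qed

text \<open>This is Vajda's identity with an arbitrary solution \<open>g\<close> in place of one
  Fibonacci factor. For fixed \<open>p\<close> and \<open>N\<close> both sides obey the recurrence
  in \<open>r\<close>; they vanish at \<open>r = 0\<close>, and \<open>r = 1\<close> is
  \<open>fib_cross_step\<close>.\<close>

lemma fib_cross:
  fixes f g :: "int \<Rightarrow> 'a::field"
  assumes f: "\<And>i. f (i + 2) = f (i + 1) + f i" "f 0 = 0" "f 1 = 1"
    and g: "\<And>i. g (i + 2) = g (i + 1) + g i"
  shows "f (p + r) * g (N + p) - f p * g (N + p + r) = (-1) powi p * f r * g N"
proof -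
  define h where "h r = f (p + r) * g (N + p) - f p * g (N + p + r) - (-1) powi p * f r * g N" for r
  have "h r = 0"
  proof (rule two_sided_fib_rec_zero)
    fix i
    have "f (p + (i + 2)) = f (p + (i + 1)) + f (p + i)"
      "g (N + p + (i + 2)) = g (N + p + (i + 1)) + g (N + p + i)"
      using f(1)[of "p + i"] g[of "N + p + i"] by (simp_all add: add.assoc)
    then show "h (i + 2) = h (i + 1) + h i"
      by (simp add: h_def f(1) algebra_simps)
  next
    show "h 0 = 0" "h 1 = 0"
      using fib_cross_step[OF f g] f(2,3) by (simp_all add: h_def)
  qed
  then show ?thesis by (simp add: h_def)
qed

lemma binomial_shift_power:
  fixes g :: "int \<Rightarrow> 'a::comm_ring_1"
  assumes step: "\<And>n. x * g (n + p) + y * g (n + q) = z * g n"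
  shows "(\<Sum>j=0..k. of_nat (k choose j) * x ^ j * y ^ (k - j) * g (n + p * int j + q * int (k - j)))
    = z ^ k * g n"
proof (induction k arbitrary: n)
  case 0
  then show ?case by simp
next
  case (Suc k)
  \<comment> \<open>\<open>T j l\<close> is the monomial
    \<open>(x * E\<^sup>p)\<^sup>j * (y * E\<^sup>q)\<^sup>l\<close> applied to \<open>g\<close> at
    \<open>n\<close>; the next equation is Pascal's rule for these monomials.\<close>
  define T where "T j l = x ^ j * y ^ l * g (n + p * int j + q * int l)" for j l
  have "(\<Sum>j=0..Suc k. of_nat (Suc k choose j) * T j (Suc k - j))
    = (\<Sum>j=0..k. of_nat (k choose j) * (T (Suc j) (k - j) + T j (Suc (k - j))))"
  proof -
    have "(\<Sum>j=0..Suc k. of_nat (Suc k choose j) * T j (Suc k - j))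
      = T 0 (Suc k) + (\<Sum>j=0..k. of_nat (k choose Suc j) * T (Suc j) (k - j))
        + (\<Sum>j=0..k. of_nat (k choose j) * T (Suc j) (k - j))"
      by (subst sum.atLeast0_atMost_Suc_shift) (simp add: algebra_simps sum.distrib)
    also have "T 0 (Suc k) + (\<Sum>j=0..k. of_nat (k choose Suc j) * T (Suc j) (k - j))
      = (\<Sum>j=0..Suc k. of_nat (k choose j) * T j (Suc k - j))"
      by (subst sum.atLeast0_atMost_Suc_shift) simp
    \<comment> \<open>The summand at \<open>j = Suc k\<close> has binomial coefficient 0.\<close>
    also have "\<dots> = (\<Sum>j=0..k. of_nat (k choose j) * T j (Suc (k - j)))"
      by (simp add: Suc_diff_le binomial_eq_0)
    finally show ?thesis by (simp add: algebra_simps sum.distrib)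
  qed
  also have "\<dots> = (\<Sum>j=0..k. z * (of_nat (k choose j) * x ^ j * y ^ (k - j)
      * g (n + p * int j + q * int (k - j))))"
  proof (rule sum.cong[OF refl])
    fix j
    define i where "i = n + p * int j + q * int (k - j)"
    \<comment> \<open>The two monomials born from the same \<open>j\<close> are exactly the left
      side of \<open>step\<close> at the index \<open>i\<close>, so they contract to one factor
      \<open>z\<close>.\<close>
    have "T (Suc j) (k - j) + T j (Suc (k - j)) = x ^ j * y ^ (k - j) * (x * g (i + p) + y * g (i + q))"
      by (simp add: T_def i_def algebra_simps)
    also have "\<dots> = z * (x ^ j * y ^ (k - j) * g i)"
      by (simp add: step)
    finally show "of_nat (k choose j) * (T (Suc j) (k - j) + T j (Suc (k - j)))
      = z * (of_nat (k choose j) * x ^ j * y ^ (k - j) * g (n + p * int j + q * int (k - j)))"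
      by (simp add: i_def)
  qed
  also have "\<dots> = z ^ Suc k * g n"
    by (simp only: sum_distrib_left[symmetric] Suc.IH power_Suc) (simp only: mult.assoc)
  finally show ?case by (simp add: T_def mult.assoc)
qed

lemma fib_binomial_sums:
  fixes G :: "int \<Rightarrow> int"
  assumes "fibonacci_like G"
  shows
    "(\<Sum>j=0..k. (-1) powi ((a + b + 1) * int (k - j)) * rat_of_int (int (k choose j) *
        fib_int (m - b) ^ j * fib_int (m - a) ^ (k - j) *
        G (n - (m - b) * int k + (a - b) * int j)))
      = rat_of_int (fib_int (a - b) ^ k * G n)" (is ?first)
    "(\<Sum>j=0..k. (-1) powi ((a + b) * int j) * rat_of_int (int (k choose j) *
        fib_int (a - b) ^ j * fib_int (m - a) ^ (k - j) *
        G (n - (a - b) * int k + (m - b) * int j)))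
      = (-1) powi ((a + b) * int k) * rat_of_int (fib_int (m - b) ^ k * G n)" (is ?second)
    "(\<Sum>j=0..k. (-1) ^ j * rat_of_int (int (k choose j) *
        fib_int (a - b) ^ j * fib_int (m - b) ^ (k - j) *
        G (n + (a - b) * int k + (m - a) * int j)))
      = (-1) powi ((a + b) * int k) * rat_of_int (fib_int (m - a) ^ k * G n)" (is ?third)
proof -
  define s :: rat where "s = (-1) powi (a + b)"
  define f where "f i = rat_of_int (fib_int i)" for i
  define g where "g i = rat_of_int (G i)" for i
  have s_sq: "s * s = 1"
    unfolding s_def by (metis power2_eq_square power_int_minus_one_mult_self)
  \<comment> \<open>\<open>a - b\<close> and \<open>a + b\<close> have the same parity.\<close>
  have s_minus: "(-1 :: rat) powi (a - b) = s"
    by (simp add: s_def power_int_minus_left)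
  have sign: "(-1 :: rat) powi ((a + b) * int l) = s ^ l"
    "(-1 :: rat) powi ((a + b + 1) * int l) = (- s) ^ l" for l
  proof -
    have "(-1 :: rat) powi (a + b + 1) = - s"
      by (simp add: s_def power_int_add)
    then show "(-1 :: rat) powi ((a + b) * int l) = s ^ l"
      "(-1 :: rat) powi ((a + b + 1) * int l) = (- s) ^ l"
      by (simp_all add: s_def power_int_mult)
  qed
  have f: "f (i + 2) = f (i + 1) + f i" "f 0 = 0" "f 1 = 1" for i
    by (simp_all add: f_def fib_int_rec)
  have g: "g (i + 2) = g (i + 1) + g i" for i
    by (simp add: g_def fibonacci_like_rec[OF assms])
  \<comment> \<open>With \<open>p = a - b\<close>, \<open>r = m - a\<close> and base
    \<open>N + b\<close>, the index \<open>p + r\<close> is \<open>m - b\<close>, and the shifted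
    indices of \<open>g\<close> are \<open>N + a\<close> and \<open>N + m\<close>.\<close>
  have key: "f (m - b) * g (N + a) - f (a - b) * g (N + m) = s * f (m - a) * g (N + b)" for N
    using fib_cross[OF f g, of "a - b" "m - a" "N + b"] by (simp add: s_minus algebra_simps)
  have key': "s * f (m - b) * g (N + a) - s * f (a - b) * g (N + m) = f (m - a) * g (N + b)" for N
  proof -
    have "s * f (m - b) * g (N + a) - s * f (a - b) * g (N + m) = s * (s * f (m - a) * g (N + b))"
      by (simp only: key[symmetric, unfolded mult.assoc] right_diff_distrib mult.assoc)
    also have "\<dots> = (s * s) * (f (m - a) * g (N + b))"
      by (simp only: mult.assoc)
    finally show ?thesis
      by (simp only: s_sq mult_1)
  qed
  \<comment> \<open>The three identities solve the same relation for different terms: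
    \<open>N = n - m\<close>, \<open>N = n - a\<close> and \<open>N = n - b\<close> turn the terms
    at \<open>N + m\<close>, \<open>N + a\<close> and \<open>N + b\<close> into the multiple of
    \<open>g n\<close>.\<close>
  have "f (m - b) * g (n + (a - m)) + (- s * f (m - a)) * g (n + (b - m)) = f (a - b) * g n" for n
    using key[of "n - m"] by (simp add: algebra_simps)
  note first = binomial_shift_power[OF this, of k n]
  have "(s * f (a - b)) * g (n + (m - a)) + f (m - a) * g (n + (b - a)) = (s * f (m - b)) * g n" for n
    using key'[of "n - a"] by (simp add: algebra_simps)
  note second = binomial_shift_power[OF this, of k n]
  have "(- f (a - b)) * g (n + (m - b)) + f (m - b) * g (n + (a - b)) = (s * f (m - a)) * g n" for n
    using key[of "n - b"] by (simp add: algebra_simps)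
  note third = binomial_shift_power[OF this, of k n]
  show ?first
  proof (rule trans[OF sum.cong[OF refl] trans[OF first]])
    fix j assume "j \<in> {0..k}"
    \<comment> \<open>As \<open>j \<le> k\<close>, \<open>int (k - j)\<close> is a true difference,
      and collecting the multiples of \<open>j\<close> and of \<open>k\<close> matches the two forms
      of the index.\<close>
    then have index: "n - (m - b) * int k + (a - b) * int j = n + (a - m) * int j + (b - m) * int (k - j)"
      by (simp add: of_nat_diff algebra_simps)
    then show "(-1) powi ((a + b + 1) * int (k - j)) * rat_of_int (int (k choose j) *
        fib_int (m - b) ^ j * fib_int (m - a) ^ (k - j) * G (n - (m - b) * int k + (a - b) * int j))
      = of_nat (k choose j) * f (m - b) ^ j * (- s * f (m - a)) ^ (k - j)
        * g (n + (a - m) * int j + (b - m) * int (k - j))"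
      unfolding index sign power_mult_distrib by (simp add: f_def g_def)
  qed (simp add: f_def g_def)
  show ?second
  proof (rule trans[OF sum.cong[OF refl] trans[OF second]])
    fix j assume "j \<in> {0..k}"
    then have index: "n - (a - b) * int k + (m - b) * int j = n + (m - a) * int j + (b - a) * int (k - j)"
      by (simp add: of_nat_diff algebra_simps)
    then show "(-1) powi ((a + b) * int j) * rat_of_int (int (k choose j) *
        fib_int (a - b) ^ j * fib_int (m - a) ^ (k - j) * G (n - (a - b) * int k + (m - b) * int j))
      = of_nat (k choose j) * (s * f (a - b)) ^ j * f (m - a) ^ (k - j)
        * g (n + (m - a) * int j + (b - a) * int (k - j))"
      unfolding index sign power_mult_distrib by (simp add: f_def g_def)
  qed (simp add: f_def g_def sign power_mult_distrib)
  show ?third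
  proof (rule trans[OF sum.cong[OF refl] trans[OF third]])
    fix j assume "j \<in> {0..k}"
    then have index: "n + (a - b) * int k + (m - a) * int j = n + (m - b) * int j + (a - b) * int (k - j)"
      by (simp add: of_nat_diff algebra_simps)
    then show "(-1) ^ j * rat_of_int (int (k choose j) *
        fib_int (a - b) ^ j * fib_int (m - b) ^ (k - j) * G (n + (a - b) * int k + (m - a) * int j))
      = of_nat (k choose j) * (- f (a - b)) ^ j * f (m - b) ^ (k - j)
        * g (n + (m - b) * int j + (a - b) * int (k - j))"
      unfolding index power_minus[of "f (a - b)"] by (simp add: f_def g_def)
  qed (simp add: f_def g_def sign power_mult_distrib)
qed

lemma minus_one_powi_cong_parity:
  assumes "even i \<longleftrightarrow> even j"
  shows "(-1 :: 'a::division_ring) powi i = (-1) powi j"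
  using assms by (simp add: power_int_minus_left)

theorem theorem2:
  fixes G :: "int \<Rightarrow> int" and k :: nat and a b n m :: int
  assumes "fibonacci_like G" and "k > 0"
  shows "
    ((\<Sum>j=0..k. (-1) powi ((a + b + 1) * int (k - j)) * rat_of_int (int (k choose j) *
            fib_int (m - b) ^ j * fib_int (m - a) ^ (k - j) *
            G (n - (m - b) * int k + (a - b) * int j)))
          = rat_of_int (fib_int (a - b) ^ k * G n)) \<and>
    ((\<Sum>j=0..k. (-1) powi ((a + b) * int j) * rat_of_int (int (k choose j) *
            fib_int (a - b) ^ j * fib_int (m - a) ^ (k - j) *
            G (n - (a - b) * int k + (m - b) * int j)))
          = (-1) powi ((a + b) * int k) * rat_of_int (fib_int (m - b) ^ k * G n)) \<and>
    ((\<Sum>j=0..k. (-1) ^ j * rat_of_int (int (k choose j) *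
            fib_int (a - b) ^ j * fib_int (m - b) ^ (k - j) *
            G (n + (a - b) * int k + (m - a) * int j)))
          = (-1) powi ((a + b) * int k) * rat_of_int (fib_int (m - a) ^ k * G n)) \<and>
    ((\<Sum>j=0..k. (-1) powi ((a + b + 1) * int (k - j)) * rat_of_int (int (k choose j) *
            fib_int (m + a) ^ j * fib_int (m + b) ^ (k - j) *
            G (n - (m + a) * int k + (a - b) * int j)))
          = rat_of_int (fib_int (a - b) ^ k * G n)) \<and>
    ((\<Sum>j=0..k. (-1) powi ((a + b) * int j) * rat_of_int (int (k choose j) *
            fib_int (a - b) ^ j * fib_int (m + b) ^ (k - j) *
            G (n - (a - b) * int k + (m + a) * int j)))
          = (-1) powi ((a + b) * int k) * rat_of_int (fib_int (m + a) ^ k * G n)) \<and>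
    ((\<Sum>j=0..k. (-1) ^ j * rat_of_int (int (k choose j) *
            fib_int (a - b) ^ j * fib_int (m + a) ^ (k - j) *
            G (n + (a - b) * int k + (m + b) * int j)))
          = (-1) powi ((a + b) * int k) * rat_of_int (fib_int (m + b) ^ k * G n))"
proof -
  \<comment> \<open>Replacing \<open>(a, b)\<close> by \<open>(- b, - a)\<close> negates
    \<open>a + b\<close>, which preserves parity and so every sign; it fixes \<open>a - b\<close>
    and sends \<open>m - b\<close>, \<open>m - a\<close> to \<open>m + a\<close>,
    \<open>m + b\<close>.\<close>
  have sign: "(-1 :: rat) powi ((- b + - a) * l) = (-1) powi ((a + b) * l)"
    "(-1 :: rat) powi ((- b + - a + 1) * l) = (-1) powi ((a + b + 1) * l)" for l
    by (rule minus_one_powi_cong_parity; simp; blast)+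
  have arg: "m - - a = m + a" "m - - b = m + b" "- b - - a = a - b"
    by simp_all
  show ?thesis
    using fib_binomial_sums[OF assms(1), where a = a and b = b and k = k and m = m and n = n]
      fib_binomial_sums
        [OF assms(1), where a = "- b" and b = "- a" and k = k and m = m and n = n, unfolded sign arg]
    by blast
qed

end
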